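(* Let $i<j$ be distinct integers and set $t=(i,j)\in S_{\mathbb{Z}}$. For each $y\in \mathcal{I}_{\mathbb{Z}}$, there exists at most one involution $z\in \mathcal{I}_{\mathbb{Z}}$ such that $$\varnothing \neq \{ wt : w\in \mathcal{A}(z),\ wt \lessdot w\} \subseteq \mathcal{A}(y).$$
   Context: $S_{\mathbb{Z}}$ is the group of permutations of $\mathbb{Z}$ fixing all but finitely many integers; products are compositions of functions; $(i,j)$ is the transposition exchanging $i$ and $j$, and $s_i=(i,i+1)$. The length $\ell(w)$ is the number of pairs of integers $i<j$ with $w(i)>w(j)$. The Bruhat order $<$ on $S_{\mathbb{Z}}$ is the weakest strict partial order with $w<wt$ whenever $t$ is a transposition with $\ell(w)<\ell(wt)$. Write $u\lessdot v$ if $\{u\}=\{\sigma\in S_{\mathbb{Z}} : u\le\sigma<v\}$. $\mathcal{I}_{\mathbb{Z}}=\{y\in S_{\mathbb{Z}}: y=y^{-1}\}$ (the identity is included). The Demazure product is the unique associative map $\circ: S_{\mathbb{Z}}\times S_{\mathbb{Z}}\to S_{\mathbb{Z}}$ with $u\circ v=uv$ if $\ell(uv)=\ell(u)+\ell(v)$ and $s_i\circ s_i=s_i$ for all $i\in\mathbb{Z}$. One has $\mathcal{I}_{\mathbb{Z}}=\{w^{-1}\circ w: w\in S_{\mathbb{Z}}\}$. For $y\in\mathcal{I}_{\mathbb{Z}}$, $\mathcal{A}(y)$ is the set of permutations $w\in S_{\mathbb{Z}}$ of minimal length such that $y=w^{-1}\circ w$. *)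

theory Defs
  imports "HOL-Combinatorics.Perm"
begin

unbundle permutation_syntax

text \<open>
  The library type \<^typ>\<open>int perm\<close> consists of the bijections of the integers that move only
  finitely many points; its product is composition of functions, so it is the group
  \<open>S\<^sub>\<int>\<close>.
\<close>

definition simple_refl :: "int \<Rightarrow> int perm" where
  "simple_refl i = \<langle>i \<leftrightarrow> i + 1\<rangle>"

definition is_transposition :: "int perm \<Rightarrow> bool" where
  "is_transposition t \<longleftrightarrow> (\<exists>a b. a \<noteq> b \<and> t = \<langle>a \<leftrightarrow> b\<rangle>)"

definition inversions :: "int perm \<Rightarrow> (int \<times> int) set" where
  "inversions w = {(i, j). i < j \<and> w \<langle>$\<rangle> i > w \<langle>$\<rangle> j}"

definition perm_length :: "int perm \<Rightarrow> nat" where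
  "perm_length w = card (inversions w)"

text \<open>The set counted by \<^const>\<open>perm_length\<close> is finite, so \<^const>\<open>card\<close> has its usual meaning.\<close>

lemma finite_inversions: "finite (inversions w)"
proof (cases "affected w = {}")
  case True
  then have "w \<langle>$\<rangle> i = i" for i
    by (simp add: affected.rep_eq)
  then have "inversions w = {}"
    by (auto simp: inversions_def)
  then show ?thesis
    by simp
next
  case False
  define a b where "a = Min (affected w)" and "b = Max (affected w)"
  have fin: "finite (affected w)"
    by simp
  have bounds: "a \<le> k \<and> k \<le> b" if "k \<in> affected w" for k
    using that fin by (simp add: a_def b_def)
  have moved: "a \<le> k \<and> k \<le> b \<and> a \<le> w \<langle>$\<rangle> k \<and> w \<langle>$\<rangle> k \<le> b" if "w \<langle>$\<rangle> k \<noteq> k" for k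
  proof -
    have "k \<in> affected w"
      using that by (simp add: in_affected)
    moreover from this have "w \<langle>$\<rangle> k \<in> affected w"
      by simp
    ultimately show ?thesis
      using bounds by blast
  qed
  have "inversions w \<subseteq> {a..b} \<times> {a..b}"
  proof
    fix p assume "p \<in> inversions w"
    then obtain i j where p: "p = (i, j)" and ij: "i < j" "w \<langle>$\<rangle> i > w \<langle>$\<rangle> j"
      by (auto simp: inversions_def)
    from ij moved[of i] moved[of j] show "p \<in> {a..b} \<times> {a..b}"
      by (cases "w \<langle>$\<rangle> i = i"; cases "w \<langle>$\<rangle> j = j") (auto simp: p)
  qed
  then show ?thesis
    by (rule finite_subset) simp
qed

inductive bruhat_less :: "int perm \<Rightarrow> int perm \<Rightarrow> bool" (infix "\<prec>" 50) where
  base: "is_transposition t \<Longrightarrow> perm_length w < perm_length (w * t) \<Longrightarrow> w \<prec> w * t"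
| trans: "u \<prec> v \<Longrightarrow> v \<prec> w \<Longrightarrow> u \<prec> w"

text \<open>
  The transitive closure above is the weakest strict partial order satisfying the base rule:
  it is itself such an order, and it is contained in every other one.
\<close>

lemma bruhat_less_imp_perm_length: "u \<prec> v \<Longrightarrow> perm_length u < perm_length v"
  by (induction rule: bruhat_less.induct) auto

lemma bruhat_less_strict_partial_order: "irreflp (\<prec>)" "transp (\<prec>)"
  using bruhat_less_imp_perm_length
  by (auto intro!: irreflpI transpI intro: bruhat_less.trans)

lemma bruhat_less_weakest:
  assumes "irreflp R" and "transp R"
    and "\<And>w t. is_transposition t \<Longrightarrow> perm_length w < perm_length (w * t) \<Longrightarrow> R w (w * t)"
    and "u \<prec> v"
  shows "R u v"
  using assms(4) by induction (use assms(2,3) in \<open>auto dest: transpD\<close>)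

definition bruhat_le :: "int perm \<Rightarrow> int perm \<Rightarrow> bool" (infix "\<preceq>" 50) where
  "u \<preceq> v \<longleftrightarrow> u = v \<or> u \<prec> v"

definition bruhat_covered :: "int perm \<Rightarrow> int perm \<Rightarrow> bool" (infix "\<lessdot>" 50) where
  "u \<lessdot> v \<longleftrightarrow> {u} = {\<sigma>. u \<preceq> \<sigma> \<and> \<sigma> \<prec> v}"

definition involutions :: "int perm set" where
  "involutions = {y. y = inverse y}"

definition is_demazure_product :: "(int perm \<Rightarrow> int perm \<Rightarrow> int perm) \<Rightarrow> bool" where
  "is_demazure_product f \<longleftrightarrow>
     (\<forall>u v w. f (f u v) w = f u (f v w)) \<and>
     (\<forall>u v. perm_length (u * v) = perm_length u + perm_length v \<longrightarrow> f u v = u * v) \<and>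
     (\<forall>i. f (simple_refl i) (simple_refl i) = simple_refl i)"

definition demazure :: "int perm \<Rightarrow> int perm \<Rightarrow> int perm" (infixl "\<odot>" 70) where
  "demazure = (THE f. is_demazure_product f)"

definition atoms :: "int perm \<Rightarrow> int perm set" where
  "atoms y = {w. is_arg_min perm_length (\<lambda>v. y = inverse v \<odot> v) w}"

end

theory Submission
  imports Defs
begin

text \<open>
  The involution \<open>z\<close> is already determined by \<open>y\<close>, \<open>i\<close>, \<open>j\<close> as soon as a single atom \<open>w\<close> of \<open>z\<close>
  has \<open>wt \<lessdot> w\<close> with \<open>wt\<close> an atom of \<open>y\<close>: then \<open>z\<close> agrees with \<open>y\<close> outside \<open>{i, j, y(i), y(j)}\<close>, and on this
  set it is given by an explicit rule, called \<open>raise i j y\<close> below (lemma \<open>atoms_swap_raise\<close>).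

  To see this, one builds \<open>w\<close> and \<open>wt\<close> up in parallel.  If \<open>w = v s\<^sub>k\<close> with \<open>v\<close> shorter than \<open>w\<close>, then
  \<open>w\<^sup>-\<^sup>1 \<circ> w = s\<^sub>k \<circ> (v\<^sup>-\<^sup>1 \<circ> v) \<circ> s\<^sub>k\<close>, and minimality of the length of \<open>w\<close> forces \<open>v\<close> to be an atom of an involution
  with an ascent at \<open>k\<close> (lemma \<open>atoms_descent\<close>).  For an involution \<open>x\<close> with an ascent at \<open>k\<close> the
  product \<open>s\<^sub>k \<circ> x \<circ> s\<^sub>k\<close> is \<open>x s\<^sub>k\<close> if \<open>x\<close> fixes \<open>k\<close> and \<open>k + 1\<close>, and the conjugate \<open>s\<^sub>k x s\<^sub>k\<close> otherwise.  The
  covering \<open>wt \<lessdot> w\<close> ensures that every descent of \<open>w\<close>, apart from the pair \<open>(i, j)\<close> itself, is also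
  one of \<open>wt\<close>.  Descents can thus be removed from both atoms simultaneously, until the
  transposition has become a simple reflection \<open>s\<^sub>k\<close> and is itself the descent of \<open>w\<close> to be removed.
  At that moment \<open>z = s\<^sub>k \<circ> y \<circ> s\<^sub>k\<close>, which is the raised involution of \<open>y\<close> (lemma \<open>raise_simple\<close>).  It remains to
  check that a simultaneous ascent step of \<open>y\<close> and \<open>z\<close> preserves the relation \<open>z = raise i j y\<close> (lemma
  \<open>raise_ascent_conj\<close>).  This is a finite inspection of the relative position of \<open>k\<close>, \<open>k + 1\<close> and the cycles of
  \<open>i\<close> and \<open>j\<close>, for which one also carries along that no cycle of \<open>y\<close> with elements between \<open>i\<close> and \<open>j\<close>
  lies between the cycles of \<open>i\<close> and \<open>j\<close>.

  The existence of the Demazure product is proved by letting the 0-Hecke monoid act on permutations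
  from the right.  This action commutes with the analogous action from the left, which makes an
  element of the monoid recoverable from the image of the identity (lemma \<open>right_word_unique\<close>).
\<close>

section \<open>Length, descents and transpositions\<close>

lemma apply_inverse_left [simp]: "inverse w \<langle>$\<rangle> (w \<langle>$\<rangle> x) = x"
  and apply_inverse_right [simp]: "w \<langle>$\<rangle> (inverse w \<langle>$\<rangle> x) = x"
  for w :: "'a perm"
  by (simp_all add: apply_sequence)

lemma apply_mult [simp]: "(v * w) \<langle>$\<rangle> x = v \<langle>$\<rangle> (w \<langle>$\<rangle> x)"
  for v w :: "'a perm"
  by (simp add: apply_times)

lemma inverse_mult: "inverse (v * w) = inverse w * inverse v" for v w :: "'a perm"
  by (rule perm_eqI) (metis apply_inverse_left apply_inverse_right apply_mult)

lemma apply_swap: "\<langle>a \<leftrightarrow> b\<rangle> \<langle>$\<rangle> x = transpose a b x"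
  by (simp add: swap.rep_eq)

text \<open>
  Multiplying by the transposition of positions \<open>a < b\<close> with \<open>w(a) < w(b)\<close> creates the inversion
  \<open>(a, b)\<close>, and the two inversions \<open>(a, c)\<close> and \<open>(c, b)\<close> for every \<open>c\<close> between \<open>a\<close> and \<open>b\<close> whose value
  lies between \<open>w(a)\<close> and \<open>w(b)\<close>.  All other inversions correspond bijectively to those of \<open>w\<close>.
\<close>

lemma perm_length_mult_swap:
  assumes ab: "a < b" and wab: "w \<langle>$\<rangle> a < w \<langle>$\<rangle> b"
  defines "B \<equiv> {c. a < c \<and> c < b \<and> w \<langle>$\<rangle> a < w \<langle>$\<rangle> c \<and> w \<langle>$\<rangle> c < w \<langle>$\<rangle> b}"
  shows "perm_length (w * \<langle>a \<leftrightarrow> b\<rangle>) = Suc (perm_length w + 2 * card B)"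
proof -
  let ?t = "transpose a b"
  define M where "M = Pair a ` B \<union> (\<lambda>c. (c, b)) ` B"
  \<comment> \<open>Relabel a pair of positions by the transposition, except a pair formed by one of \<open>a, b\<close> and a
    position \<open>c\<close> strictly between them: there \<open>(a, c)\<close> is an inversion after the swap if it was one
    before, and likewise \<open>(c, b)\<close>.\<close>
  define \<psi> where "\<psi> = (\<lambda>(p, q). if p = a \<and> q < b \<or> q = b \<and> a < p then (p, q) else (?t p, ?t q))"
  have \<psi>_invol: "\<psi> (\<psi> x) = x" if "fst x < snd x" for x
    using that ab by (cases x) (auto simp: \<psi>_def transpose_def)
  have fin: "finite B"
    by (rule finite_subset[of _ "{a..b}"]) (auto simp: B_def)
  have "inversions (w * \<langle>a \<leftrightarrow> b\<rangle>) = insert (a, b) (\<psi> ` inversions w \<union> M)"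
  proof (intro equalityI subsetI)
    fix x assume x: "x \<in> inversions (w * \<langle>a \<leftrightarrow> b\<rangle>)"
    show "x \<in> insert (a, b) (\<psi> ` inversions w \<union> M)"
    proof (cases "x = (a, b) \<or> x \<in> M")
      case False
      have "\<psi> x \<in> inversions w"
        using x False ab wab apply_inj[of w]
        by (cases x) (auto simp: \<psi>_def inversions_def apply_swap transpose_def M_def B_def image_iff
            not_less order_le_less split: if_splits)
      moreover have "x = \<psi> (\<psi> x)"
        using x by (subst \<psi>_invol) (auto simp: inversions_def)
      ultimately show ?thesis
        by blast
    qed auto
  next
    fix x assume "x \<in> insert (a, b) (\<psi> ` inversions w \<union> M)"
    then show "x \<in> inversions (w * \<langle>a \<leftrightarrow> b\<rangle>)"
      using ab wab
      by (auto simp: \<psi>_def inversions_def apply_swap transpose_def M_def B_def split: if_splits)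
  qed
  moreover have "(a, b) \<notin> \<psi> ` inversions w \<union> M"
    using ab wab by (auto simp: \<psi>_def inversions_def transpose_def M_def B_def split: if_splits)
  moreover have "\<psi> ` inversions w \<inter> M = {}"
    using ab wab by (auto simp: \<psi>_def inversions_def transpose_def M_def B_def split: if_splits)
  moreover have "card (\<psi> ` inversions w) = perm_length w"
    unfolding perm_length_def
    by (intro card_image inj_on_inverseI[of _ \<psi>] \<psi>_invol) (auto simp: inversions_def)
  moreover have "card M = 2 * card B"
    unfolding M_def using fin
    by (subst card_Un_disjoint) (auto simp: card_image inj_on_def B_def)
  ultimately show ?thesis
    using fin finite_inversions[of w] by (simp add: perm_length_def card_Un_disjoint M_def)
qed

lemma transpose_succ_less_iff:
  fixes k p q :: int
  assumes "\<not> (p = k \<and> q = k + 1)" "\<not> (p = k + 1 \<and> q = k)"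
  shows "transpose k (k + 1) p < transpose k (k + 1) q \<longleftrightarrow> p < q"
  using assms by (auto simp: transpose_def)

lemma apply_simple_refl: "simple_refl k \<langle>$\<rangle> x = transpose k (k + 1) x"
  by (simp add: simple_refl_def apply_swap)

lemma simple_refl_square [simp]: "simple_refl k * simple_refl k = 1" "w * simple_refl k * simple_refl k = w"
    "simple_refl k * (simple_refl k * w) = w"
  by (simp_all add: simple_refl_def mult.assoc mult.assoc[symmetric, of "\<langle>k \<leftrightarrow> k + 1\<rangle>"])

lemma inverse_simple_refl [simp]: "inverse (simple_refl k) = simple_refl k"
  by (simp add: simple_refl_def)

lemma perm_length_ascent:
  assumes "w \<langle>$\<rangle> k < w \<langle>$\<rangle> (k + 1)"
  shows "perm_length (w * simple_refl k) = Suc (perm_length w)"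
proof -
  have "{c. k < c \<and> c < k + 1 \<and> w \<langle>$\<rangle> k < w \<langle>$\<rangle> c \<and> w \<langle>$\<rangle> c < w \<langle>$\<rangle> (k + 1)} = {}"
    by auto
  then show ?thesis
    using perm_length_mult_swap[of k "k + 1" w] assms
    unfolding simple_refl_def by (metis add.right_neutral card.empty less_add_one mult_0_right)
qed

lemma ascent_or_descent:
  "w \<langle>$\<rangle> k < w \<langle>$\<rangle> (k + 1) \<or> w \<langle>$\<rangle> (k + 1) < w \<langle>$\<rangle> k" for w :: "int perm"
  using apply_inj[of w k "k + 1"] by linarith

lemma perm_length_descent:
  assumes "w \<langle>$\<rangle> (k + 1) < w \<langle>$\<rangle> k"
  shows "Suc (perm_length (w * simple_refl k)) = perm_length w"
  using perm_length_ascent[of "w * simple_refl k" k] assms by (simp add: apply_simple_refl)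

lemma perm_length_one [simp]: "perm_length 1 = 0"
proof -
  have "inversions 1 = {}"
    by (auto simp: inversions_def)
  then show ?thesis
    by (simp add: perm_length_def)
qed

lemma perm_length_simple_refl [simp]: "perm_length (simple_refl k) = 1"
  using perm_length_ascent[of 1 k] by simp

lemma perm_length_inverse [simp]: "perm_length (inverse w) = perm_length w"
proof -
  have "bij_betw (\<lambda>(i, j). (w \<langle>$\<rangle> j, w \<langle>$\<rangle> i)) (inversions w) (inversions (inverse w))"
    by (rule bij_betw_byWitness[where f' = "\<lambda>(i, j). (inverse w \<langle>$\<rangle> j, inverse w \<langle>$\<rangle> i)"])
      (auto simp: inversions_def)
  then show ?thesis
    unfolding perm_length_def by (metis bij_betw_same_card)
qed

text \<open>
  Without descents, \<open>w(k) - k\<close> never decreases as \<open>k\<close> grows, and it vanishes far to the left and far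
  to the right; so it vanishes everywhere.
\<close>

lemma ex_descent:
  fixes w :: "int perm"
  assumes "w \<noteq> 1"
  obtains k where "w \<langle>$\<rangle> (k + 1) < w \<langle>$\<rangle> k"
proof -
  have "\<exists>k. w \<langle>$\<rangle> (k + 1) < w \<langle>$\<rangle> k"
  proof (rule ccontr)
    assume "\<nexists>k. w \<langle>$\<rangle> (k + 1) < w \<langle>$\<rangle> k"
    then have asc: "w \<langle>$\<rangle> k + 1 \<le> w \<langle>$\<rangle> (k + 1)" for k
      using ascent_or_descent[of w k] by (simp add: zless_imp_add1_zle)
    have grow: "w \<langle>$\<rangle> x + int n \<le> w \<langle>$\<rangle> (x + int n)" for x n
    proof (induction n)
      case (Suc n)
      then show ?case
        using asc[of "x + int n"] by (simp add: algebra_simps)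
    qed simp
    have fin: "finite (affected w)" and "affected w \<noteq> {}"
      using assms by simp_all
    define m M where "m = Min (affected w) - 1" and "M = Max (affected w) + 1"
    have fixed: "w \<langle>$\<rangle> m = m" "w \<langle>$\<rangle> M = M"
      using Min_le[OF fin, of m] Max_ge[OF fin, of M] by (auto simp: m_def M_def in_affected)
    have "w \<langle>$\<rangle> x = x" if "x \<in> affected w" for x
    proof -
      have "m < x" "x < M"
        using Min_le[OF fin that] Max_ge[OF fin that] by (simp_all add: m_def M_def)
      then show ?thesis
        using grow[of m "nat (x - m)"] grow[of x "nat (M - x)"] fixed by simp
    qed
    then show False
      using \<open>affected w \<noteq> {}\<close> by (auto simp: in_affected simp del: affected_empty_iff)
  qed
  then show ?thesis
    using that by blast
qed

lemma bruhat_less_swap: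
  assumes "a < b" "w \<langle>$\<rangle> a < w \<langle>$\<rangle> b"
  shows "w \<prec> w * \<langle>a \<leftrightarrow> b\<rangle>"
proof (rule bruhat_less.base)
  show "is_transposition \<langle>a \<leftrightarrow> b\<rangle>"
    using assms(1) unfolding is_transposition_def by (metis less_irrefl)
  show "perm_length w < perm_length (w * \<langle>a \<leftrightarrow> b\<rangle>)"
    by (simp add: perm_length_mult_swap[OF assms])
qed

text \<open>
  If the value of some \<open>c\<close> between \<open>i\<close> and \<open>j\<close> were intermediate, then the pattern 123 of \<open>wt\<close> at the
  positions \<open>i, c, j\<close> could be turned into the pattern 321 of \<open>w\<close> through 213 and 312, going up in the
  Bruhat order at every stage.
\<close>

lemma bruhat_covered_swapD:
  assumes "i < j" and "w * \<langle>i \<leftrightarrow> j\<rangle> \<lessdot> w"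
  shows "w \<langle>$\<rangle> j < w \<langle>$\<rangle> i"
    and "\<And>c. i < c \<Longrightarrow> c < j \<Longrightarrow> \<not> (w \<langle>$\<rangle> j < w \<langle>$\<rangle> c \<and> w \<langle>$\<rangle> c < w \<langle>$\<rangle> i)"
proof -
  let ?u = "w * \<langle>i \<leftrightarrow> j\<rangle>"
  have set: "{?u} = {\<sigma>. ?u \<preceq> \<sigma> \<and> \<sigma> \<prec> w}"
    using assms(2) by (simp add: bruhat_covered_def)
  then have "?u \<prec> w"
    by blast
  then have less: "perm_length ?u < perm_length w"
    by (rule bruhat_less_imp_perm_length)
  show desc: "w \<langle>$\<rangle> j < w \<langle>$\<rangle> i"
  proof (rule ccontr)
    assume "\<not> w \<langle>$\<rangle> j < w \<langle>$\<rangle> i"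
    then have "w \<langle>$\<rangle> i < w \<langle>$\<rangle> j"
      using assms(1) apply_inj[of w i j] by linarith
    from bruhat_less_imp_perm_length[OF bruhat_less_swap[OF assms(1) this]] less show False
      by simp
  qed
  show "\<not> (w \<langle>$\<rangle> j < w \<langle>$\<rangle> c \<and> w \<langle>$\<rangle> c < w \<langle>$\<rangle> i)" if c: "i < c" "c < j" for c
  proof
    assume wc: "w \<langle>$\<rangle> j < w \<langle>$\<rangle> c \<and> w \<langle>$\<rangle> c < w \<langle>$\<rangle> i"
    let ?s = "?u * \<langle>i \<leftrightarrow> c\<rangle>"
    have 1: "?u \<prec> ?s"
      using c wc by (intro bruhat_less_swap) (auto simp: apply_swap transpose_def)
    have "?s \<prec> ?s * \<langle>i \<leftrightarrow> j\<rangle>"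
      using c wc by (intro bruhat_less_swap) (auto simp: apply_swap transpose_def)
    moreover have "?s * \<langle>i \<leftrightarrow> j\<rangle> \<prec> ?s * \<langle>i \<leftrightarrow> j\<rangle> * \<langle>c \<leftrightarrow> j\<rangle>"
      using c wc by (intro bruhat_less_swap) (auto simp: apply_swap transpose_def)
    moreover have "?s * \<langle>i \<leftrightarrow> j\<rangle> * \<langle>c \<leftrightarrow> j\<rangle> = w"
      using c by (intro perm_eqI) (auto simp: apply_swap transpose_def)
    ultimately have "?s \<prec> w"
      using bruhat_less.trans by metis
    then have "?s = ?u"
      using set 1 by (auto simp: bruhat_le_def)
    then show False
      using bruhat_less_imp_perm_length[OF 1] by simp
  qed
qed

section \<open>The Demazure product\<close>

text \<open>
  Every permutation is reached from the identity by right multiplications with simple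
  reflections that each raise the length.
\<close>

lemma perm_induct_ascent [case_names one ascent]:
  assumes "P 1"
    and step: "\<And>w k. P w \<Longrightarrow> w \<langle>$\<rangle> k < w \<langle>$\<rangle> (k + 1) \<Longrightarrow> P (w * simple_refl k)"
  shows "P w"
proof (induction "perm_length w" arbitrary: w rule: less_induct)
  case less
  show ?case
  proof (cases "w = 1")
    case False
    then obtain k where k: "w \<langle>$\<rangle> (k + 1) < w \<langle>$\<rangle> k"
      by (rule ex_descent)
    then have "P (w * simple_refl k)"
      using perm_length_descent[OF k] by (intro less) simp
    then show ?thesis
      using step[of "w * simple_refl k" k] k by (simp add: apply_simple_refl)
  qed (use assms(1) in simp)
qed

lemma perm_length_mult_le: "perm_length (u * v) \<le> perm_length u + perm_length v"
proof (induction v rule: perm_induct_ascent)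
  case (ascent v k)
  have "perm_length (u * v * simple_refl k) \<le> Suc (perm_length (u * v))"
    using ascent_or_descent[of "u * v" k] perm_length_ascent[of "u * v" k] perm_length_descent[of "u * v" k]
    by linarith
  then show ?case
    using ascent perm_length_ascent[of v k] by (simp add: mult.assoc)
qed simp

text \<open>
  These will turn out to be \<open>w \<mapsto> w \<circ> s\<^sub>k\<close> and \<open>w \<mapsto> s\<^sub>k \<circ> w\<close> for the Demazure product \<open>\<circ>\<close>.
\<close>

definition right_op :: "int \<Rightarrow> int perm \<Rightarrow> int perm" where
  "right_op k w = (if w \<langle>$\<rangle> k < w \<langle>$\<rangle> (k + 1) then w * simple_refl k else w)"

definition left_op :: "int \<Rightarrow> int perm \<Rightarrow> int perm" where
  "left_op k w = inverse (right_op k (inverse w))"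

lemma left_op_eq:
  "left_op k w = (if inverse w \<langle>$\<rangle> k < inverse w \<langle>$\<rangle> (k + 1) then simple_refl k * w else w)"
  by (simp add: left_op_def right_op_def inverse_mult)

text \<open>
  Left multiplication by \<open>s\<^sub>k\<close> changes the relative order of the values at the positions \<open>l\<close> and \<open>l + 1\<close>
  only if these values are \<open>k\<close> and \<open>k + 1\<close>.  In that case \<open>s\<^sub>k w = w s\<^sub>l\<close>, and both sides are equal
  to the longer one of \<open>w\<close> and \<open>w s\<^sub>l\<close>.
\<close>

lemma right_op_left_op: "right_op l (left_op k w) = left_op k (right_op l w)"
proof -
  let ?v = "inverse w"
  have shift: "?v \<langle>$\<rangle> k = l \<longleftrightarrow> w \<langle>$\<rangle> l = k" "?v \<langle>$\<rangle> k = l + 1 \<longleftrightarrow> w \<langle>$\<rangle> (l + 1) = k"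
    "?v \<langle>$\<rangle> (k + 1) = l \<longleftrightarrow> w \<langle>$\<rangle> l = k + 1" "?v \<langle>$\<rangle> (k + 1) = l + 1 \<longleftrightarrow> w \<langle>$\<rangle> (l + 1) = k + 1"
    by (metis apply_inverse_left apply_inverse_right)+
  consider (up) "w \<langle>$\<rangle> l = k" "w \<langle>$\<rangle> (l + 1) = k + 1"
    | (down) "w \<langle>$\<rangle> l = k + 1" "w \<langle>$\<rangle> (l + 1) = k"
    | (other) "\<not> (w \<langle>$\<rangle> l = k \<and> w \<langle>$\<rangle> (l + 1) = k + 1)" "\<not> (w \<langle>$\<rangle> l = k + 1 \<and> w \<langle>$\<rangle> (l + 1) = k)"
    by blast
  then show ?thesis
  proof cases
    case up
    then have v: "?v \<langle>$\<rangle> k = l" "?v \<langle>$\<rangle> (k + 1) = l + 1"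
      using shift by auto
    have "simple_refl k * w = w * simple_refl l"
    proof (rule perm_eqI)
      fix x
      show "(simple_refl k * w) \<langle>$\<rangle> x = (w * simple_refl l) \<langle>$\<rangle> x"
        using up apply_inj[of w x l] apply_inj[of w x "l + 1"]
        by (auto simp: apply_simple_refl transpose_def)
    qed
    then show ?thesis
      using up v by (simp add: left_op_eq right_op_def apply_simple_refl inverse_mult)
  next
    case down
    then have v: "?v \<langle>$\<rangle> (k + 1) = l" "?v \<langle>$\<rangle> k = l + 1"
      using shift by auto
    then show ?thesis
      using down by (simp add: left_op_eq right_op_def)
  next
    case other
    have "(simple_refl k * w) \<langle>$\<rangle> l < (simple_refl k * w) \<langle>$\<rangle> (l + 1) \<longleftrightarrow> w \<langle>$\<rangle> l < w \<langle>$\<rangle> (l + 1)"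
      using other by (simp add: apply_simple_refl transpose_succ_less_iff)
    moreover have "inverse (w * simple_refl l) \<langle>$\<rangle> k < inverse (w * simple_refl l) \<langle>$\<rangle> (k + 1)
        \<longleftrightarrow> ?v \<langle>$\<rangle> k < ?v \<langle>$\<rangle> (k + 1)"
      unfolding inverse_mult apply_mult inverse_simple_refl apply_simple_refl
      using other shift by (intro transpose_succ_less_iff) auto
    ultimately show ?thesis
      by (auto simp: left_op_eq right_op_def mult.assoc)
  qed
qed

text \<open>
  The composites of right operators form the 0-Hecke monoid, acting on its regular representation.
\<close>

inductive right_word :: "(int perm \<Rightarrow> int perm) \<Rightarrow> bool" where
  id: "right_word (\<lambda>w. w)"
| op: "right_word F \<Longrightarrow> right_word (\<lambda>w. right_op k (F w))"

lemma right_word_left_op: "right_word F \<Longrightarrow> F (left_op k w) = left_op k (F w)"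
  by (induction rule: right_word.induct) (simp_all add: right_op_left_op)

lemma right_word_comp: "right_word G \<Longrightarrow> right_word F \<Longrightarrow> right_word (\<lambda>w. G (F w))"
  by (induction rule: right_word.induct) (auto intro: right_word.op)

lemma right_word_reduced:
  "\<exists>F. right_word F \<and> F 1 = v \<and>
     (\<forall>u. perm_length (u * v) = perm_length u + perm_length v \<longrightarrow> F u = u * v)"
proof (induction v rule: perm_induct_ascent)
  case one
  show ?case
    using right_word.id by (intro exI[of _ "\<lambda>w. w"]) simp
next
  case (ascent v k)
  then obtain F where F: "right_word F" "F 1 = v"
    "\<And>u. perm_length (u * v) = perm_length u + perm_length v \<Longrightarrow> F u = u * v"
    by blast
  have "right_op k (F u) = u * (v * simple_refl k)"
    if "perm_length (u * (v * simple_refl k)) = perm_length u + perm_length (v * simple_refl k)" for u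
  proof -
    have len: "perm_length (u * v * simple_refl k) = Suc (perm_length u + perm_length v)"
      using that perm_length_ascent[OF ascent(2)] by (simp add: mult.assoc)
    with perm_length_mult_le[of u v] have up: "(u * v) \<langle>$\<rangle> k < (u * v) \<langle>$\<rangle> (k + 1)"
      using ascent_or_descent[of "u * v" k] perm_length_descent[of "u * v" k] by linarith
    then have "F u = u * v"
      using len perm_length_ascent[OF up] by (intro F(3)) simp
    then show ?thesis
      using up by (simp add: right_op_def mult.assoc)
  qed
  then show ?case
    using F(1,2) ascent(2) right_word.op[OF F(1), of k]
    by (intro exI[of _ "\<lambda>u. right_op k (F u)"]) (simp add: right_op_def)
qed

text \<open>
  A composite of right operators is determined by its value at the identity, because it commutes
  with the left operators and these produce every permutation from the identity.  This is what
  makes the Demazure product independent of the choice of reduced words.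
\<close>

lemma right_word_unique:
  assumes "right_word F" "right_word G" "F 1 = G 1"
  shows "F w = G w"
proof -
  \<comment> \<open>Right multiplication of \<open>w\<close> by \<open>s\<^sub>k\<close> is left multiplication of its inverse by \<open>s\<^sub>k\<close>.\<close>
  have "F (inverse w) = G (inverse w)" for w
  proof (induction w rule: perm_induct_ascent)
    case (ascent w k)
    have "inverse (w * simple_refl k) = left_op k (inverse w)"
      using ascent(2) by (simp add: left_op_eq inverse_mult)
    then show ?case
      using ascent(1) assms(1,2) by (simp add: right_word_left_op)
  qed (use assms(3) in simp)
  from this[of "inverse w"] show ?thesis
    by simp
qed

text \<open>
  The product \<open>u \<circ> v\<close> is the value at \<open>u\<close> of the composite of right operators that sends 1 to \<open>v\<close>.
\<close>

lemma ex_demazure_product: "\<exists>f. is_demazure_product f"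
proof -
  obtain F where F: "\<And>v. right_word (F v)" "\<And>v. F v 1 = v"
    "\<And>u v. perm_length (u * v) = perm_length u + perm_length v \<Longrightarrow> F v u = u * v"
    using right_word_reduced by metis
  have "F w (F v u) = F (F w v) u" for u v w
    by (rule right_word_unique[OF right_word_comp[OF F(1) F(1)] F(1)]) (simp add: F(2))
  moreover have "F (simple_refl k) (simple_refl k) = simple_refl k" for k
  proof -
    have "F (simple_refl k) u = right_op k u" for u
      by (rule right_word_unique[OF F(1) right_word.op[OF right_word.id]]) (simp add: F(2) right_op_def)
    then show ?thesis
      by (simp add: right_op_def apply_simple_refl)
  qed
  ultimately show ?thesis
    using F(3) by (intro exI[of _ "\<lambda>u v. F v u"]) (simp add: is_demazure_product_def)
qed

text \<open>
  At an ascent the product with a simple reflection has additive length.  At a descent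
  \<open>u = (u s\<^sub>k) \<circ> s\<^sub>k\<close>, so that \<open>u \<circ> s\<^sub>k = u\<close> follows from \<open>s\<^sub>k \<circ> s\<^sub>k = s\<^sub>k\<close>.
\<close>

lemma demazure_product_simple:
  assumes "is_demazure_product f"
  shows "f u 1 = u" "f 1 u = u" "f u (simple_refl k) = right_op k u" "f (simple_refl k) u = left_op k u"
proof -
  have assoc: "f (f u v) w = f u (f v w)"
    and prod: "perm_length (u * v) = perm_length u + perm_length v \<Longrightarrow> f u v = u * v"
    and idem: "f (simple_refl k) (simple_refl k) = simple_refl k" for u v w k
    using assms by (auto simp: is_demazure_product_def)
  show "f u 1 = u" "f 1 u = u"
    by (simp_all add: prod)
  have asc: "f u (simple_refl k) = u * simple_refl k" if "u \<langle>$\<rangle> k < u \<langle>$\<rangle> (k + 1)" for u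
    using perm_length_ascent[OF that] by (simp add: prod)
  show "f u (simple_refl k) = right_op k u"
  proof (cases "u \<langle>$\<rangle> k < u \<langle>$\<rangle> (k + 1)")
    case False
    let ?u = "u * simple_refl k"
    have "f ?u (simple_refl k) = u"
      using False ascent_or_descent[of u k] by (subst asc) (simp_all add: apply_simple_refl)
    then have "f u (simple_refl k) = u"
      using assoc[of ?u "simple_refl k" "simple_refl k"] idem by simp
    then show ?thesis
      using False by (simp add: right_op_def)
  qed (simp add: asc right_op_def)
  have asc': "f (simple_refl k) u = simple_refl k * u" if "inverse u \<langle>$\<rangle> k < inverse u \<langle>$\<rangle> (k + 1)" for u
  proof (rule prod)
    have "perm_length (simple_refl k * u) = perm_length (inverse u * simple_refl k)"
      by (metis inverse_simple_refl inverse_mult perm_length_inverse)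
    then show "perm_length (simple_refl k * u) = perm_length (simple_refl k) + perm_length u"
      using perm_length_ascent[OF that] by simp
  qed
  show "f (simple_refl k) u = left_op k u"
  proof (cases "inverse u \<langle>$\<rangle> k < inverse u \<langle>$\<rangle> (k + 1)")
    case False
    let ?u = "simple_refl k * u"
    have "f (simple_refl k) ?u = u"
      using False ascent_or_descent[of "inverse u" k]
      by (subst asc') (simp_all add: apply_simple_refl inverse_mult)
    then have "f (simple_refl k) u = u"
      using assoc[of "simple_refl k" "simple_refl k" ?u] idem by simp
    then show ?thesis
      using False by (simp add: left_op_eq)
  qed (simp add: asc' left_op_eq)
qed

lemma is_demazure_product_demazure: "is_demazure_product (\<odot>)"
proof -
  have "f u v = g u v" if fg: "is_demazure_product f" "is_demazure_product g" for f g u v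
  proof (induction v rule: perm_induct_ascent)
    case one
    show ?case
      using fg by (simp add: demazure_product_simple)
  next
    case (ascent v k)
    have "h u (v * simple_refl k) = right_op k (h u v)" if h: "is_demazure_product h" for h
    proof -
      have "h u (v * simple_refl k) = h u (h v (simple_refl k))"
        using ascent(2) by (simp add: demazure_product_simple[OF h] right_op_def)
      also have "\<dots> = right_op k (h u v)"
        using h demazure_product_simple(3)[OF h] by (metis is_demazure_product_def)
      finally show ?thesis .
    qed
    from this[OF fg(1)] this[OF fg(2)] show ?case
      using ascent(1) by simp
  qed
  then have "\<exists>!f. is_demazure_product f"
    using ex_demazure_product by (auto intro!: ext)
  then show ?thesis
    unfolding demazure_def by (rule theI')
qed

lemma demazure_assoc: "(u \<odot> v) \<odot> w = u \<odot> (v \<odot> w)"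
  using is_demazure_product_demazure by (simp add: is_demazure_product_def)

lemmas demazure_simple = demazure_product_simple[OF is_demazure_product_demazure]

section \<open>Atoms\<close>

text \<open>
  For an involution \<open>y\<close> with \<open>y(k) < y(k + 1)\<close> this is \<open>s\<^sub>k \<circ> y \<circ> s\<^sub>k\<close>.  It is stated for functions, since
  the comparison of involutions below only concerns their values.
\<close>

definition ascent_conj :: "int \<Rightarrow> (int \<Rightarrow> int) \<Rightarrow> int \<Rightarrow> int" where
  "ascent_conj k y =
     (if y k = k \<and> y (k + 1) = k + 1 then y \<circ> transpose k (k + 1)
      else transpose k (k + 1) \<circ> y \<circ> transpose k (k + 1))"

lemma inverse_demazure_step:
  assumes "w \<langle>$\<rangle> k < w \<langle>$\<rangle> (k + 1)"
  shows "inverse (w * simple_refl k) \<odot> (w * simple_refl k) = left_op k (right_op k (inverse w \<odot> w))"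
proof -
  have w: "w * simple_refl k = w \<odot> simple_refl k"
    using assms by (simp add: demazure_simple right_op_def)
  have "inverse (w * simple_refl k) = simple_refl k \<odot> inverse w"
    using assms by (simp add: demazure_simple left_op_eq inverse_mult)
  then have "inverse (w * simple_refl k) \<odot> (w * simple_refl k)
      = simple_refl k \<odot> (inverse w \<odot> w) \<odot> simple_refl k"
    by (simp only: w demazure_assoc)
  then show ?thesis
    by (simp add: demazure_simple right_op_left_op)
qed

lemma inverse_demazure_involution: "inverse (inverse w \<odot> w) = inverse w \<odot> w"
proof (induction w rule: perm_induct_ascent)
  case one
  show ?case
    using demazure_simple(1)[of 1] by simp
next
  case (ascent w k)
  have "inverse (left_op k (right_op k y)) = right_op k (left_op k (inverse y))" for y
    by (simp add: left_op_def)
  then show ?case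
    unfolding inverse_demazure_step[OF ascent(2)] by (simp only: ascent(1) right_op_left_op)
qed

lemma left_op_right_op_ascent:
  assumes "inverse y = y" and "y \<langle>$\<rangle> k < y \<langle>$\<rangle> (k + 1)"
  shows "apply (left_op k (right_op k y)) = ascent_conj k (apply y)"
proof -
  have "left_op k (right_op k y) = (if y \<langle>$\<rangle> k = k \<and> y \<langle>$\<rangle> (k + 1) = k + 1
      then y * simple_refl k else simple_refl k * (y * simple_refl k))"
  proof (cases "y \<langle>$\<rangle> k = k \<and> y \<langle>$\<rangle> (k + 1) = k + 1")
    case True
    then show ?thesis
      using assms by (simp add: right_op_def left_op_eq inverse_mult apply_simple_refl)
  next
    case False
    have "transpose k (k + 1) (y \<langle>$\<rangle> k) < transpose k (k + 1) (y \<langle>$\<rangle> (k + 1))"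
      using assms(2) False by (subst transpose_succ_less_iff) auto
    then show ?thesis
      unfolding if_not_P[OF False]
      using assms by (simp add: right_op_def left_op_eq inverse_mult apply_simple_refl)
  qed
  then show ?thesis
    by (auto simp: ascent_conj_def apply_simple_refl fun_eq_iff)
qed

lemma left_op_right_op_descent:
  assumes "inverse y = y" and "\<not> y \<langle>$\<rangle> k < y \<langle>$\<rangle> (k + 1)"
  shows "left_op k (right_op k y) = y"
  using assms by (simp add: right_op_def left_op_eq)

lemma atoms_iff:
  "w \<in> atoms z \<longleftrightarrow>
     inverse w \<odot> w = z \<and> (\<forall>v. inverse v \<odot> v = z \<longrightarrow> perm_length w \<le> perm_length v)"
  unfolding atoms_def is_arg_min_def by (auto simp: not_less)

lemma atoms_involution: "w \<in> atoms z \<Longrightarrow> inverse z = z"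
  using inverse_demazure_involution by (auto simp: atoms_iff)

lemma apply_involution: "inverse z = z \<Longrightarrow> z \<langle>$\<rangle> (z \<langle>$\<rangle> x) = x"
  by (metis apply_inverse_left)

text \<open>
  Removing a descent from an atom leaves an atom, of an involution that has an ascent at the same
  place.  For if \<open>k\<close> were a descent of \<open>z'\<close>, then \<open>z = z'\<close> would have the shorter factorization
  through \<open>w s\<^sub>k\<close>; and a shorter factorization of \<open>z'\<close> would give a shorter one of \<open>z\<close>.
\<close>

lemma atoms_descent:
  assumes w: "w \<in> atoms z" and k: "w \<langle>$\<rangle> (k + 1) < w \<langle>$\<rangle> k"
  obtains z' where "w * simple_refl k \<in> atoms z'" "z' \<langle>$\<rangle> k < z' \<langle>$\<rangle> (k + 1)"
    "apply z = ascent_conj k (apply z')"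
proof -
  define w' where "w' = w * simple_refl k"
  define z' where "z' = inverse w' \<odot> w'"
  have inv: "inverse z' = z'"
    unfolding z'_def by (rule inverse_demazure_involution)
  have w_eq: "w = w' * simple_refl k"
    by (simp add: w'_def)
  have len: "Suc (perm_length w') = perm_length w"
    unfolding w'_def by (rule perm_length_descent[OF k])
  have z: "inverse w \<odot> w = z" and min: "\<And>v. inverse v \<odot> v = z \<Longrightarrow> perm_length w \<le> perm_length v"
    using w by (auto simp: atoms_iff)
  have z_eq: "z = left_op k (right_op k z')"
    using inverse_demazure_step[of w' k] k z
    by (simp add: z'_def w_eq[symmetric]) (simp add: w'_def apply_simple_refl)
  have asc: "z' \<langle>$\<rangle> k < z' \<langle>$\<rangle> (k + 1)"
  proof (rule ccontr)
    assume "\<not> z' \<langle>$\<rangle> k < z' \<langle>$\<rangle> (k + 1)"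
    then have "z' = z"
      using left_op_right_op_descent[OF inv] z_eq by simp
    then show False
      using min[of w'] len by (simp add: z'_def)
  qed
  have "perm_length w' \<le> perm_length v" if v: "inverse v \<odot> v = z'" for v
  proof (cases "v \<langle>$\<rangle> k < v \<langle>$\<rangle> (k + 1)")
    case True
    then have "inverse (v * simple_refl k) \<odot> (v * simple_refl k) = z"
      by (simp only: inverse_demazure_step[OF True] v z_eq)
    then show ?thesis
      using min[of "v * simple_refl k"] perm_length_ascent[OF True] len by simp
  next
    case False
    \<comment> \<open>Now \<open>z'\<close> has \<open>s\<^sub>k\<close> as a factor on both sides, so that multiplying by \<open>s\<^sub>k\<close> once more has no effect.\<close>
    have idem: "left_op k (left_op k x) = left_op k x" "right_op k (right_op k x) = right_op k x" for x
      by (auto simp: left_op_def right_op_def apply_simple_refl)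
    define v' where "v' = v * simple_refl k"
    have "z' = left_op k (right_op k (inverse v' \<odot> v'))"
      using inverse_demazure_step[of v' k] False ascent_or_descent[of v k] v
      by (simp add: v'_def apply_simple_refl)
    then have "z = z'"
      using z_eq by (simp add: right_op_left_op idem)
    then show ?thesis
      using min[of v] v len by simp
  qed
  then have "w' \<in> atoms z'"
    by (simp add: atoms_iff z'_def)
  then show ?thesis
    using that[of z'] asc left_op_right_op_ascent[OF inv asc] z_eq by (simp add: w'_def)
qed

section \<open>Raising an involution\<close>

text \<open>
  Two cycles that cross or lie side by side are comparable in this way, nested ones are not.
\<close>

definition cycle_less :: "(int \<Rightarrow> int) \<Rightarrow> int \<Rightarrow> int \<Rightarrow> bool" where
  "cycle_less y p q \<longleftrightarrow> min p (y p) < min q (y q) \<and> max p (y p) < max q (y q)"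

text \<open>
  Besides the position of the cycles of \<open>i\<close> and \<open>j\<close>, this records what remains of the covering
  condition \<open>wt \<lessdot> w\<close>: in an atom of \<open>y\<close>, any cycle strictly between those of \<open>i\<close> and \<open>j\<close> also takes
  values strictly between the values at \<open>i\<close> and \<open>j\<close>, so it must not have elements between \<open>i\<close> and \<open>j\<close>.
\<close>

definition unobstructed :: "int \<Rightarrow> int \<Rightarrow> (int \<Rightarrow> int) \<Rightarrow> bool" where
  "unobstructed i j y \<longleftrightarrow>
     i < j \<and> cycle_less y i j \<and> (\<forall>e. i < e \<and> e < j \<longrightarrow> \<not> (cycle_less y i e \<and> cycle_less y e j))"

text \<open>
  The explicit candidate for the involution above \<open>y\<close>.  Let \<open>{a \<le> b}\<close> and \<open>{c \<le> d}\<close> be the cycles of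
  \<open>i\<close> and \<open>j\<close>.  If \<open>a < b = i < j = c < d\<close>, then these cycles become \<open>{a, c}\<close> and \<open>{b, d}\<close>.  Otherwise
  \<open>a\<close> and \<open>d\<close> are joined, while \<open>b\<close> and \<open>c\<close> are joined if the two cycles cross and fixed if they do
  not.  The updates of \<open>a\<close> and \<open>d\<close> come after those of \<open>b\<close> and \<open>c\<close> in the second branch because
  \<open>a = b\<close> or \<open>c = d\<close> may hold there.
\<close>

definition raise :: "int \<Rightarrow> int \<Rightarrow> (int \<Rightarrow> int) \<Rightarrow> int \<Rightarrow> int" where
  "raise i j y =
     (let a = min i (y i); b = max i (y i); c = min j (y j); d = max j (y j)
      in if a < i \<and> j < d then y(a := c, c := a, b := d, d := b)
         else if b < c then y(b := b, c := c, a := d, d := a)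
         else y(a := d, d := a, b := c, c := b))"

lemma cycle_less_descent:
  assumes "y k < y (k + 1)"
  shows "\<not> cycle_less y (k + 1) k"
  using assms by (auto simp: cycle_less_def)

text \<open>
  An ascent step creates no new comparable pairs of cycles.  It can destroy some, by nesting two
  cycles or by joining two fixed points.
\<close>

lemma cycle_less_ascent_conjD:
  assumes inv: "\<And>x. y (y x) = x" and asc: "y k < y (k + 1)"
    and "cycle_less (ascent_conj k y) (transpose k (k + 1) p) (transpose k (k + 1) q)"
  shows "cycle_less y p q"
proof (cases "y k = k \<and> y (k + 1) = k + 1")
  case True
  have *: "y x \<noteq> k" "y x \<noteq> k + 1" if "x \<noteq> k" "x \<noteq> k + 1" for x
    using that True inv[of x] by metis+
  show ?thesis
    using assms(3) True *[of p] *[of q]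
    by (auto simp: ascent_conj_def cycle_less_def transpose_def split: if_splits)
next
  case False
  have ne: "y k \<noteq> k + 1" "y (k + 1) \<noteq> k"
    using inv[of k] inv[of "k + 1"] asc by auto
  have "y k = p \<longleftrightarrow> y p = k" "y (k + 1) = p \<longleftrightarrow> y p = k + 1" "y k = q \<longleftrightarrow> y q = k" "y (k + 1) = q \<longleftrightarrow> y q = k + 1"
    using inv by metis+
  then show ?thesis
    using assms(3) False ne asc
    unfolding ascent_conj_def cycle_less_def transpose_def
    by (smt (verit) comp_apply)
qed

text \<open>
  An obstruction after an ascent step comes from one before.  The order of \<open>i\<close>, \<open>e\<close> and \<open>j\<close> could
  only differ if two of them are \<open>k\<close> and \<open>k + 1\<close>, and as \<open>k\<close> is an ascent, the cycle of \<open>k + 1\<close> is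
  never to the left of that of \<open>k\<close>.
\<close>

lemma unobstructed_ascent_conj:
  assumes inv: "\<And>x. y (y x) = x" and asc: "y k < y (k + 1)" and un: "unobstructed i j y"
    and ne: "\<not> (k = i \<and> k + 1 = j)"
    and less: "cycle_less (ascent_conj k y) (transpose k (k + 1) i) (transpose k (k + 1) j)"
  shows "unobstructed (transpose k (k + 1) i) (transpose k (k + 1) j) (ascent_conj k y)"
  unfolding unobstructed_def
proof (intro conjI allI impI notI)
  let ?r = "transpose k (k + 1)"
  show "?r i < ?r j"
    using un ne by (subst transpose_succ_less_iff) (auto simp: unobstructed_def)
  show "cycle_less (ascent_conj k y) (?r i) (?r j)"
    by (fact less)
  fix e' assume e': "?r i < e' \<and> e' < ?r j"
    "cycle_less (ascent_conj k y) (?r i) e' \<and> cycle_less (ascent_conj k y) e' (?r j)"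
  define e where "e = ?r e'"
  have e'_eq: "e' = ?r e"
    by (simp add: e_def)
  have "cycle_less y i e" "cycle_less y e j"
    using e'(2) cycle_less_ascent_conjD[OF inv asc] by (auto simp: e'_eq)
  moreover from this have "i < e" "e < j"
    using e'(1) cycle_less_descent[OF asc] unfolding e'_eq
    by (auto simp: transpose_def split: if_splits)
  ultimately show False
    using un by (auto simp: unobstructed_def)
qed

text \<open>
  The ordered endpoints of the two cycles, in a form that avoids minima and maxima.
\<close>

lemma unobstructed_cases:
  assumes inv: "\<And>x. y (y x) = x" and un: "unobstructed i j y"
  obtains a b c d where "a \<le> b" "c \<le> d" "a < c" "b < d" "i < j" "i = a \<or> i = b" "j = c \<or> j = d"
    "y a = b" "y b = a" "y c = d" "y d = c"
    "\<And>e. cycle_less y i e \<longleftrightarrow> a < min e (y e) \<and> b < max e (y e)"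
    "\<And>e. cycle_less y e j \<longleftrightarrow> min e (y e) < c \<and> max e (y e) < d"
proof
  define a b c d where "a = min i (y i)" and "b = max i (y i)" and "c = min j (y j)" and "d = max j (y j)"
  note defs = this
  show "a \<le> b" "c \<le> d" "a < c" "b < d" "i < j" "i = a \<or> i = b" "j = c \<or> j = d"
    "y a = b" "y b = a" "y c = d" "y d = c"
    "\<And>e. cycle_less y i e \<longleftrightarrow> a < min e (y e) \<and> b < max e (y e)"
    "\<And>e. cycle_less y e j \<longleftrightarrow> min e (y e) < c \<and> max e (y e) < d"
    using un inv by (auto simp: defs unobstructed_def cycle_less_def min_def max_def)
qed

lemma raise_eq:
  assumes "a \<le> b" "c \<le> d" "i = a \<or> i = b" "j = c \<or> j = d"
    "y a = b" "y b = a" "y c = d" "y d = c"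
  shows "raise i j y =
    (if a < i \<and> j < d then y(a := c, c := a, b := d, d := b)
     else if b < c then y(b := b, c := c, a := d, d := a)
     else y(a := d, d := a, b := c, c := b))"
proof -
  have "min i (y i) = a" "max i (y i) = b" "min j (y j) = c" "max j (y j) = d"
    using assms by auto
  then show ?thesis
    by (simp add: raise_def)
qed

lemma cycle_lessI:
  assumes "a \<le> b" "c \<le> d" "i = a \<or> i = b" "j = c \<or> j = d"
    "y a = b" "y b = a" "y c = d" "y d = c" "a < c" "b < d"
  shows "cycle_less y i j"
  using assms by (auto simp: cycle_less_def)

lemma conj_fun_upd:
  "transpose k l \<circ> f(p := q) \<circ> transpose k l
    = (transpose k l \<circ> f \<circ> transpose k l)(transpose k l p := transpose k l q)"
  by (auto simp: fun_eq_iff transpose_def)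

text \<open>
  The definition of \<^const>\<open>raise\<close> depends only on the relative order of the endpoints \<open>a, b, c, d\<close>.
  This order survives the exchange of \<open>k\<close> and \<open>k + 1\<close> unless both are endpoints.
\<close>

lemma raise_conj:
  fixes a b c d k :: int
  defines "r \<equiv> transpose k (k + 1)"
  assumes ord: "a \<le> b" "c \<le> d" "a < c" "b < d" and ij: "i < j" "i = a \<or> i = b" "j = c \<or> j = d"
    and y: "y a = b" "y b = a" "y c = d" "y d = c"
    and E: "\<not> {k, k + 1} \<subseteq> {a, b, c, d}"
  shows "r \<circ> raise i j y \<circ> r = raise (r i) (r j) (r \<circ> y \<circ> r)"
    and "cycle_less (r \<circ> y \<circ> r) (r i) (r j)"
proof -
  have lt: "r p < r q \<longleftrightarrow> p < q" if "p \<in> {a, b, c, d}" "q \<in> {a, b, c, d}" for p q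
    using that E unfolding r_def by (intro transpose_succ_less_iff) auto
  have le: "r p \<le> r q \<longleftrightarrow> p \<le> q" if "p \<in> {a, b, c, d}" "q \<in> {a, b, c, d}" for p q
    using lt[of q p] that by auto
  have rr: "r (r x) = x" for x
    by (simp add: r_def)
  have ij': "r i = r a \<or> r i = r b" "r j = r c \<or> r j = r d"
    using ij by auto
  have y': "(r \<circ> y \<circ> r) (r a) = r b" "(r \<circ> y \<circ> r) (r b) = r a"
    "(r \<circ> y \<circ> r) (r c) = r d" "(r \<circ> y \<circ> r) (r d) = r c"
    using y by (auto simp: rr)
  have ord': "r a \<le> r b" "r c \<le> r d" "r a < r c" "r b < r d"
    using ord le lt by auto
  have 1: "r a < r i \<longleftrightarrow> a < i" "r j < r d \<longleftrightarrow> j < d" "r b < r c \<longleftrightarrow> b < c"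
    using ij lt by auto
  show "r \<circ> raise i j y \<circ> r = raise (r i) (r j) (r \<circ> y \<circ> r)"
    unfolding raise_eq[OF ord(1,2) ij(2,3) y] raise_eq[OF ord'(1,2) ij' y'] 1
    by (simp add: r_def conj_fun_upd)
  show "cycle_less (r \<circ> y \<circ> r) (r i) (r j)"
    by (rule cycle_lessI[OF ord'(1,2) ij' y' ord'(3,4)])
qed

text \<open>
  The heart of the proof: an ascent step taken simultaneously by \<open>y\<close> and by its raised involution
  \<open>z\<close> carries the relation between them along.  The two steps are of the same type, both
  conjugations or both multiplications, unless \<open>k\<close> or \<open>k + 1\<close> is one of the endpoints
  \<open>a, b, c, d\<close>.  In each of these exceptional situations the ascents of \<open>y\<close> and \<open>z\<close> or the absence
  of obstructions leave at most one shape to examine.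
\<close>

lemma raise_ascent_conj:
  assumes inv: "\<And>x. y (y x) = x" and un: "unobstructed i j y"
    and asc: "y k < y (k + 1)" and asc': "raise i j y k < raise i j y (k + 1)"
    and ne: "\<not> (k = i \<and> k + 1 = j)"
  defines "r \<equiv> transpose k (k + 1)"
  shows "ascent_conj k (raise i j y) = raise (r i) (r j) (ascent_conj k y)"
    and "cycle_less (ascent_conj k y) (r i) (r j)"
proof -
  obtain a b c d where ord: "a \<le> b" "c \<le> d" "a < c" "b < d"
    and ij: "i < j" "i = a \<or> i = b" "j = c \<or> j = d"
    and y: "y a = b" "y b = a" "y c = d" "y d = c"
    and less1: "\<And>e. cycle_less y i e \<longleftrightarrow> a < min e (y e) \<and> b < max e (y e)"
    and less2: "\<And>e. cycle_less y e j \<longleftrightarrow> min e (y e) < c \<and> max e (y e) < d"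
    by (rule unobstructed_cases[OF inv un]) (rule that)
  note z = raise_eq[OF ord(1,2) ij(2,3) y]
  define E where "E = {a, b, c, d}"
  have off: "raise i j y e = y e" if "e \<notin> E" for e
    using that by (auto simp: z E_def)
  consider
      (both) "{k, k + 1} \<subseteq> E"
    | (conj) "\<not> {k, k + 1} \<subseteq> E" "\<not> (y k = k \<and> y (k + 1) = k + 1)"
        "\<not> (raise i j y k = k \<and> raise i j y (k + 1) = k + 1)"
    | (none) "k \<notin> E" "k + 1 \<notin> E" "y k = k" "y (k + 1) = k + 1"
    | (low) "k \<in> E" "k + 1 \<notin> E" "y k = k" "y (k + 1) = k + 1"
    | (high) "k \<notin> E" "k + 1 \<in> E" "y k = k" "y (k + 1) = k + 1"
    | (z_fixes) "\<not> {k, k + 1} \<subseteq> E" "\<not> (y k = k \<and> y (k + 1) = k + 1)"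
        "raise i j y k = k" "raise i j y (k + 1) = k + 1"
    by blast
  then have "ascent_conj k (raise i j y) = raise (r i) (r j) (ascent_conj k y) \<and>
     cycle_less (ascent_conj k y) (r i) (r j)"
  proof cases
    case both
    \<comment> \<open>Any other pair of adjacent endpoints is a descent of \<open>y\<close> or of \<open>z\<close>, or equals \<open>(i, j)\<close>.\<close>
    have "k = b \<and> k + 1 = c \<and> a < b \<and> c < d"
      using both asc asc' ne ord ij y by (auto simp: E_def z split: if_splits)
    then have *: "b = k" "c = k + 1" "a < k" "k + 1 < d"
      by auto
    \<comment> \<open>Hence \<open>z\<close> fixes \<open>k\<close> and \<open>k + 1\<close>, and joins them in this step, while \<open>y\<close> is conjugated and its two
      cycles start to cross.\<close>
    have nex: "\<not> (a < i \<and> j < d)"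
      using ij ne * by auto
    have z': "raise i j y = y(k := k, k + 1 := k + 1, a := d, d := a)"
      using nex * by (auto simp: z)
    have r: "r a = a" "r k = k + 1" "r (k + 1) = k" "r d = d"
      using * by (auto simp: r_def)
    have "ascent_conj k y = r \<circ> y \<circ> r"
      using * y by (auto simp: ascent_conj_def r_def)
    have y': "(r \<circ> y \<circ> r) a = k + 1" "(r \<circ> y \<circ> r) (k + 1) = a"
      "(r \<circ> y \<circ> r) k = d" "(r \<circ> y \<circ> r) d = k"
      using * y r by auto
    have ord': "a \<le> k + 1" "k \<le> d" and ij': "r i = a \<or> r i = k + 1" "r j = k \<or> r j = d"
      using ij * r by auto
    have "raise (r i) (r j) (r \<circ> y \<circ> r) =
       (r \<circ> y \<circ> r)(a := d, d := a, k + 1 := k, k := k + 1)"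
    proof (subst raise_eq[OF ord' ij' y'])
      show "(if a < r i \<and> r j < d
           then (r \<circ> y \<circ> r)(a := k, k := a, k + 1 := d, d := k + 1)
           else if k + 1 < k
                then (r \<circ> y \<circ> r)(k + 1 := k + 1, k := k, a := d, d := a)
                else (r \<circ> y \<circ> r)(a := d, d := a, k + 1 := k, k := k + 1)) =
         (r \<circ> y \<circ> r)(a := d, d := a, k + 1 := k, k := k + 1)"
        using nex ij * r by auto
    qed
    also have "\<dots> = raise i j y \<circ> r"
    proof
      fix x
      have "r (y (r x)) = y (r x)" if "x \<noteq> a" "x \<noteq> d" "x \<noteq> k" "x \<noteq> k + 1"
        using that * y inv by (metis r_def transpose_apply_other)
      then show "((r \<circ> y \<circ> r)(a := d, d := a, k + 1 := k, k := k + 1)) x = (raise i j y \<circ> r) x"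
        using * by (auto simp: z' r_def transpose_def)
    qed
    also have "\<dots> = ascent_conj k (raise i j y)"
      using * by (auto simp: ascent_conj_def r_def z')
    finally have "raise (r i) (r j) (r \<circ> y \<circ> r) = ascent_conj k (raise i j y)" .
    moreover have "cycle_less (r \<circ> y \<circ> r) (r i) (r j)"
      using * by (intro cycle_lessI[OF ord' ij' y']) auto
    ultimately show ?thesis
      using \<open>ascent_conj k y = r \<circ> y \<circ> r\<close> by simp
  next
    case conj
    then show ?thesis
      using raise_conj[OF ord ij y, of k] by (auto simp: ascent_conj_def r_def E_def)
  next
    case none
    have r: "r e = e" if "e \<in> E" for e
      using that none by (auto simp: r_def intro!: transpose_apply_other)
    have rE: "i \<in> E" "j \<in> E" "a \<in> E" "b \<in> E" "c \<in> E" "d \<in> E"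
      using ij by (auto simp: E_def)
    have upd: "f(p := q) \<circ> r = (f \<circ> r)(p := q)" if "p \<in> E" for f :: "int \<Rightarrow> int" and p q
    proof
      have "p \<noteq> k" "p \<noteq> k + 1"
        using that none by auto
      then show "(f(p := q) \<circ> r) x = ((f \<circ> r)(p := q)) x" for x
        by (auto simp: r_def transpose_def)
    qed
    have y': "(y \<circ> r) a = b" "(y \<circ> r) b = a" "(y \<circ> r) c = d" "(y \<circ> r) d = c"
      using y r rE by auto
    have "raise (r i) (r j) (y \<circ> r) = raise i j y \<circ> r"
      unfolding r[OF rE(1)] r[OF rE(2)] z raise_eq[OF ord(1,2) ij(2,3) y']
      using rE by (simp add: upd)
    moreover have "cycle_less (y \<circ> r) (r i) (r j)"
      unfolding r[OF rE(1)] r[OF rE(2)]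
      by (rule cycle_lessI[OF ord(1,2) ij(2,3) y' ord(3,4)])
    moreover have "ascent_conj k y = y \<circ> r" "ascent_conj k (raise i j y) = raise i j y \<circ> r"
      using none off by (simp_all add: ascent_conj_def r_def)
    ultimately show ?thesis
      by simp
  next
    case low
    \<comment> \<open>Here \<open>k\<close> is a fixed point of \<open>y\<close> equal to \<open>i\<close> or \<open>j\<close>.  For \<open>k = i\<close> the value \<open>z(k) = d\<close> exceeds
      \<open>z(k + 1) = k + 1\<close>, which is a descent.\<close>
    have False if "k = i"
      using that low asc' ord ij y by (auto simp: E_def z split: if_splits)
    moreover have "k = a \<and> k = b \<or> k = c \<and> k = d"
      using low(1,3) y unfolding E_def by (metis empty_iff insert_iff)
    ultimately have *: "k = j" "c = k" "d = k"
      using ij by auto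
    have bk: "b < k"
      using * ord by simp
    have r: "r a = a" "r b = b" "r i = i" "r k = k + 1" "r (k + 1) = k"
      using bk ord ij by (auto simp: r_def)
    have z': "raise i j y = y(b := b, a := k, k := a)"
      using * bk by (simp add: z)
    have y': "(y \<circ> r) a = b" "(y \<circ> r) b = a" "(y \<circ> r) k = k + 1" "(y \<circ> r) (k + 1) = k"
      using y r low by auto
    have rj: "r j = k + 1"
      using *(1) r(4) by simp
    have ord': "a \<le> b" "k \<le> k + 1" and ij': "r i = a \<or> r i = b" "r j = k \<or> r j = k + 1"
      using ij ord r * by auto
    have "raise (r i) (r j) (y \<circ> r) = (y \<circ> r)(b := b, k := k, a := k + 1, k + 1 := a)"
      using bk rj by (subst raise_eq[OF ord' ij' y']) simp
    also have "\<dots> = r \<circ> raise i j y \<circ> r"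
    proof
      fix x
      have "r (y (r x)) = y (r x)" if "x \<noteq> k" "x \<noteq> k + 1"
        using that low inv by (metis r_def transpose_apply_other)
      then show "((y \<circ> r)(b := b, k := k, a := k + 1, k + 1 := a)) x = (r \<circ> raise i j y \<circ> r) x"
        using bk ord low r by (auto simp: z' r_def transpose_def)
    qed
    also have "\<dots> = ascent_conj k (raise i j y)"
      using bk ord by (auto simp: ascent_conj_def r_def z')
    finally have "raise (r i) (r j) (y \<circ> r) = ascent_conj k (raise i j y)" .
    moreover have "ascent_conj k y = y \<circ> r"
      using low(3,4) by (simp add: ascent_conj_def r_def)
    moreover have "cycle_less (y \<circ> r) (r i) (r j)"
      using ord(3,4) * by (intro cycle_lessI[OF ord' ij' y']) auto
    ultimately show ?thesis
      by simp
  next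
    case high
    \<comment> \<open>This is the mirror image of the preceding case.\<close>
    have False if "k + 1 = j"
      using that high asc' ord ij y by (auto simp: E_def z split: if_splits)
    moreover have "k + 1 = a \<and> k + 1 = b \<or> k + 1 = c \<and> k + 1 = d"
      using high(2,4) y unfolding E_def by (metis empty_iff insert_iff)
    ultimately have *: "k + 1 = i" "a = k + 1" "b = k + 1"
      using ij by auto
    have ck: "k + 1 < c"
      using * ord by simp
    have r: "r c = c" "r d = d" "r j = j" "r k = k + 1" "r (k + 1) = k"
      using ck ord ij by (auto simp: r_def)
    have z': "raise i j y = y(c := c, k + 1 := d, d := k + 1)"
      using * ck by (auto simp: z)
    have y': "(y \<circ> r) k = k + 1" "(y \<circ> r) (k + 1) = k" "(y \<circ> r) c = d" "(y \<circ> r) d = c"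
      using y r high by auto
    have ri: "r i = k"
      using *(1) r(5) by simp
    have ord': "k \<le> k + 1" "c \<le> d" and ij': "r i = k \<or> r i = k + 1" "r j = c \<or> r j = d"
      using ij ord r * by auto
    have "raise (r i) (r j) (y \<circ> r) = (y \<circ> r)(k + 1 := k + 1, c := c, k := d, d := k)"
      using ck ri by (subst raise_eq[OF ord' ij' y']) simp
    also have "\<dots> = r \<circ> raise i j y \<circ> r"
    proof
      fix x
      have "r (y (r x)) = y (r x)" if "x \<noteq> k" "x \<noteq> k + 1"
        using that high inv by (metis r_def transpose_apply_other)
      then show "((y \<circ> r)(k + 1 := k + 1, c := c, k := d, d := k)) x = (r \<circ> raise i j y \<circ> r) x"
        using ck ord high r by (auto simp: z' r_def transpose_def)
    qed
    also have "\<dots> = ascent_conj k (raise i j y)"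
      using ck ord by (auto simp: ascent_conj_def r_def z')
    finally have "raise (r i) (r j) (y \<circ> r) = ascent_conj k (raise i j y)" .
    moreover have "ascent_conj k y = y \<circ> r"
      using high(3,4) by (simp add: ascent_conj_def r_def)
    moreover have "cycle_less (y \<circ> r) (r i) (r j)"
      using ord(3,4) ck * by (intro cycle_lessI[OF ord' ij' y']) auto
    ultimately show ?thesis
      by simp
  next
    case z_fixes
    have z_fixed: "b < c \<and> (e = b \<and> a < b \<or> e = c \<and> c < d)" if "e \<in> E" "raise i j y e = e" for e
    proof -
      have "b \<noteq> c"
        using y(2,3) ord by auto
      then have "raise i j y a \<noteq> a" "raise i j y d \<noteq> d"
        using ord by (auto simp: z)
      moreover have "b < c \<and> a < b" if "raise i j y b = b"
        using that ord \<open>b \<noteq> c\<close> by (auto simp: z split: if_splits)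
      moreover have "b < c \<and> c < d" if "raise i j y c = c"
        using that ord \<open>b \<noteq> c\<close> by (auto simp: z split: if_splits)
      ultimately show ?thesis
        using that unfolding E_def by blast
    qed
    \<comment> \<open>One of \<open>k\<close>, \<open>k + 1\<close> is \<open>b\<close> or \<open>c\<close>, and the other one is a fixed point of \<open>y\<close> between \<open>b\<close> and \<open>c\<close>,
      which obstructs \<open>i\<close> and \<open>j\<close>.\<close>
    obtain e where e: "b < e" "e < c" "y e = e"
    proof (cases "k \<in> E")
      case True
      with z_fixes have "k + 1 \<notin> E"
        by blast
      moreover from this have "y (k + 1) = k + 1"
        using z_fixes off by metis
      moreover have "b < c" "k = b \<or> k = c \<and> c < d"
        using z_fixed[OF True] z_fixes by blast+
      ultimately show ?thesis
        using that[of "k + 1"] asc y(3) by (auto simp: E_def)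
    next
      case False
      then have "y k = k"
        using z_fixes off by metis
      moreover from this have "k + 1 \<in> E"
        using z_fixes off by metis
      moreover from this have "b < c" "k + 1 = b \<and> a < b \<or> k + 1 = c"
        using z_fixed[of "k + 1"] z_fixes by blast+
      ultimately show ?thesis
        using that[of k] asc y(2) False by (auto simp: E_def)
    qed
    have "i < e" "e < j" "cycle_less y i e" "cycle_less y e j"
      using e ij ord less1[of e] less2[of e] by auto
    then have False
      using un by (auto simp: unobstructed_def)
    then show ?thesis ..
  qed
  then show "ascent_conj k (raise i j y) = raise (r i) (r j) (ascent_conj k y)"
    and "cycle_less (ascent_conj k y) (r i) (r j)"
    by auto
qed

text \<open>
  This starts the comparison: raising at the adjacent points \<open>k\<close> and \<open>k + 1\<close> is the step
  \<open>y \<mapsto> s\<^sub>k \<circ> y \<circ> s\<^sub>k\<close>.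
\<close>

lemma raise_simple:
  assumes inv: "\<And>x. y (y x) = x" and asc: "y k < y (k + 1)"
  shows "unobstructed k (k + 1) y" and "ascent_conj k y = raise k (k + 1) y"
proof -
  have ne: "y k \<noteq> k + 1" "y (k + 1) \<noteq> k"
    using inv[of k] inv[of "k + 1"] asc by auto
  show un: "unobstructed k (k + 1) y"
    using asc ne by (auto simp: unobstructed_def cycle_less_def)
  have other: "y x \<noteq> k \<and> y x \<noteq> k + 1" if "x \<noteq> y k" "x \<noteq> y (k + 1)" for x
    using that inv by metis
  show "ascent_conj k y = raise k (k + 1) y"
  proof
    fix x
    show "ascent_conj k y x = raise k (k + 1) y x"
      using asc ne inv[of k] inv[of "k + 1"] other[of x]
      by (cases "y k < k"; cases "k + 1 < y (k + 1)"; cases "x = k \<or> x = k + 1")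
        (auto simp: ascent_conj_def raise_def Let_def transpose_def min_def max_def)
  qed
qed

section \<open>Uniqueness of the involution above\<close>

text \<open>
  Induction on the length of \<open>w\<close>, removing a descent \<open>k\<close>.  As \<open>w\<close> takes no value between \<open>w(j)\<close> and
  \<open>w(i)\<close> at positions between \<open>i\<close> and \<open>j\<close>, every descent of \<open>w\<close> other than \<open>(i, j)\<close> itself is a descent of \<open>wt\<close>,
  so that it can be removed from both atoms at once; this replaces \<open>t\<close> by \<open>s\<^sub>k t s\<^sub>k\<close>.
\<close>

lemma atoms_swap_raise:
  assumes "i < j" and "w \<langle>$\<rangle> j < w \<langle>$\<rangle> i"
    and "\<And>c. i < c \<Longrightarrow> c < j \<Longrightarrow> \<not> (w \<langle>$\<rangle> j < w \<langle>$\<rangle> c \<and> w \<langle>$\<rangle> c < w \<langle>$\<rangle> i)"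
    and "w \<in> atoms z" and "w * \<langle>i \<leftrightarrow> j\<rangle> \<in> atoms y"
  shows "unobstructed i j (apply y) \<and> apply z = raise i j (apply y)"
  using assms
proof (induction "perm_length w" arbitrary: w i j y z rule: less_induct)
  case less
  have "w \<noteq> 1"
    using less.prems(1,2) by auto
  then obtain k where k: "w \<langle>$\<rangle> (k + 1) < w \<langle>$\<rangle> k"
    by (rule ex_descent)
  obtain z' where z': "w * simple_refl k \<in> atoms z'" "z' \<langle>$\<rangle> k < z' \<langle>$\<rangle> (k + 1)"
    "apply z = ascent_conj k (apply z')"
    using atoms_descent[OF less.prems(4) k] .
  show ?case
  proof (cases "k = i \<and> k + 1 = j")
    case True
    then have "z' = y"
      using z'(1) less.prems(5) by (auto simp: atoms_iff simple_refl_def)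
    then show ?thesis
      using raise_simple[of "apply y" k] apply_involution[OF atoms_involution[OF less.prems(5)]]
        True z' by auto
  next
    case False
    define r where "r = transpose k (k + 1)"
    have r_less: "r p < r q \<longleftrightarrow> p < q" if "\<not> (p = k \<and> q = k + 1)" "\<not> (p = k + 1 \<and> q = k)" for p q
      unfolding r_def by (rule transpose_succ_less_iff[OF that])
    have rr: "r (r x) = x" for x
      by (simp add: r_def)
    define w' where "w' = w * simple_refl k"
    have w': "w' \<langle>$\<rangle> x = w \<langle>$\<rangle> (r x)" for x
      by (simp add: w'_def r_def apply_simple_refl)
    let ?u = "w * \<langle>i \<leftrightarrow> j\<rangle>"
    have "?u \<langle>$\<rangle> (k + 1) < ?u \<langle>$\<rangle> k"
    proof -
      consider "k = i" | "k + 1 = j" "k \<noteq> i" | "k + 1 = i" | "k = j" | "k \<notin> {i, j}" "k + 1 \<notin> {i, j}"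
        by blast
      then show ?thesis
      proof cases
        case 1
        then have "\<not> w \<langle>$\<rangle> j < w \<langle>$\<rangle> (k + 1)" "k + 1 \<noteq> j"
          using less.prems(1) less.prems(3)[of "k + 1"] k False by auto
        then show ?thesis
          using 1 apply_inj[of w j "k + 1"] by (simp add: apply_swap)
      next
        case 2
        then have "\<not> w \<langle>$\<rangle> k < w \<langle>$\<rangle> i"
          using less.prems(1) less.prems(3)[of k] k by auto
        then show ?thesis
          using 2 apply_inj[of w k i] by (auto simp: apply_swap)
      next
        case 3
        then show ?thesis
          using k less.prems(1,2) by (auto simp: apply_swap)
      next
        case 4
        then show ?thesis
          using k less.prems(1,2) by (auto simp: apply_swap)
      next
        case 5
        then show ?thesis
          using k by (simp add: apply_swap)
      qed
    qed
    then obtain y' where y': "?u * simple_refl k \<in> atoms y'" "y' \<langle>$\<rangle> k < y' \<langle>$\<rangle> (k + 1)"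
      "apply y = ascent_conj k (apply y')"
      using atoms_descent[OF less.prems(5)] by blast
    have u': "?u * simple_refl k = w' * \<langle>r i \<leftrightarrow> r j\<rangle>"
      by (rule perm_eqI) (auto simp: w'_def apply_simple_refl apply_swap r_def transpose_def)
    have "unobstructed (r i) (r j) (apply y') \<and> apply z' = raise (r i) (r j) (apply y')"
    proof (rule less.hyps)
      show "perm_length w' < perm_length w"
        unfolding w'_def using perm_length_descent[OF k] by simp
      show "r i < r j"
        using r_less[of i j] less.prems(1) False by auto
      show "w' \<langle>$\<rangle> (r j) < w' \<langle>$\<rangle> (r i)"
        using less.prems(2) by (simp add: w' rr)
      show "w' \<in> atoms z'"
        using z'(1) by (simp add: w'_def)
      show "w' * \<langle>r i \<leftrightarrow> r j\<rangle> \<in> atoms y'"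
        using y'(1) by (simp add: u')
      show "\<not> (w' \<langle>$\<rangle> (r j) < w' \<langle>$\<rangle> c \<and> w' \<langle>$\<rangle> c < w' \<langle>$\<rangle> (r i))" if c: "r i < c" "c < r j" for c
      proof
        assume *: "w' \<langle>$\<rangle> (r j) < w' \<langle>$\<rangle> c \<and> w' \<langle>$\<rangle> c < w' \<langle>$\<rangle> (r i)"
        have "\<not> (i = k + 1 \<and> r c = k)" "\<not> (i = k \<and> r c = k + 1)"
          using c(1) * k rr by (auto simp: w' r_def)
        then have "i < r c"
          using c(1) r_less[of i "r c"] by (auto simp: rr)
        moreover have "\<not> (r c = k + 1 \<and> j = k)" "\<not> (r c = k \<and> j = k + 1)"
          using c(2) * k rr by (auto simp: w' r_def)
        then have "r c < j"
          using c(2) r_less[of "r c" j] by (auto simp: rr)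
        ultimately show False
          using less.prems(3)[of "r c"] * by (simp add: w' rr)
      qed
    qed
    then have un: "unobstructed (r i) (r j) (apply y')" and z'_eq: "apply z' = raise (r i) (r j) (apply y')"
      by auto
    have inv: "apply y' (apply y' x) = x" for x
      using apply_involution[OF atoms_involution[OF y'(1)]] .
    have ne: "\<not> (k = r i \<and> k + 1 = r j)"
      using less.prems(1) by (auto simp: r_def transpose_def split: if_splits)
    note step = raise_ascent_conj[OF inv un y'(2) z'(2)[unfolded z'_eq] ne]
    have "apply z = raise i j (apply y)"
      unfolding z'(3) y'(3) z'_eq using step(1) by (simp only: r_def[symmetric] rr)
    moreover have "unobstructed i j (apply y)"
      unfolding y'(3) using unobstructed_ascent_conj[OF inv y'(2) un ne step(2)]
      by (simp only: r_def[symmetric] rr)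
    ultimately show ?thesis
      by blast
  qed
qed

theorem theorem1p3:
  fixes i j :: int and t y :: "int perm"
  assumes "i < j" and "t = \<langle>i \<leftrightarrow> j\<rangle>" and "y \<in> involutions"
  shows "\<exists>\<^sub>\<le>\<^sub>1 z. z \<in> involutions \<and>
           {w * t | w. w \<in> atoms z \<and> w * t \<lessdot> w} \<noteq> {} \<and>
           {w * t | w. w \<in> atoms z \<and> w * t \<lessdot> w} \<subseteq> atoms y"
proof -
  define covered where "covered z = {w * t | w. w \<in> atoms z \<and> w * t \<lessdot> w}" for z
  have raised: "apply z = raise i j (apply y)" if ne: "covered z \<noteq> {}" and sub: "covered z \<subseteq> atoms y" for z
  proof -
    obtain w where w: "w \<in> atoms z" "w * \<langle>i \<leftrightarrow> j\<rangle> \<lessdot> w" "w * \<langle>i \<leftrightarrow> j\<rangle> \<in> atoms y"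
      using ne sub unfolding covered_def assms(2) by blast
    note cover = bruhat_covered_swapD[OF assms(1) w(2)]
    have "unobstructed i j (apply y) \<and> apply z = raise i j (apply y)"
      by (rule atoms_swap_raise[OF assms(1) cover(1) _ w(1,3)]) (rule cover(2))
    then show ?thesis
      by blast
  qed
  have "z = z'"
    if "covered z \<noteq> {}" "covered z \<subseteq> atoms y" "covered z' \<noteq> {}" "covered z' \<subseteq> atoms y" for z z'
    using raised[OF that(1,2)] raised[OF that(3,4)] by (intro perm_eqI) simp
  then show ?thesis
    unfolding covered_def[symmetric] by (intro Uniq_I) blast
qed

end
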